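(* Let $\Gamma$ be a small Coxeter graph. If $\Gamma$ has a connected component that is not an affine Coxeter graph, then the Artin group $A[\Gamma]$ does not admit the congruence subgroup property with respect to its integral generalised Burau representation $\tilde\sigma$.
   Context: A Coxeter matrix on the finite set $\{1,\dots,n\}$ is a symmetric matrix $(m_{i,j})$ with $m_{i,i}=1$ and $m_{i,j}\in\{2,3,\dots\}\cup\{\infty\}$ for $i\ne j$. Its Coxeter graph $\Gamma$ has vertices $1,\dots,n$, with $i,j$ joined by an edge when $m_{i,j}\ge 3$ (including $\infty$), labelled by $m_{i,j}$ if $m_{i,j}\ge4$. $\Gamma$ is small if every $m_{i,j}\in\{1,2,3,\infty\}$. The Artin group is $A[\Gamma]=\langle a_1,\dots,a_n \mid \underbrace{a_ia_ja_i\cdots}_{m_{i,j}}=\underbrace{a_ja_ia_j\cdots}_{m_{i,j}} \text{ for } i\neq j,\ m_{i,j}<\infty\rangle$. A connected small Coxeter graph is affine if it is one of the affine Coxeter graphs $\tilde A_1$ (two vertices with $m=\infty$), $\tilde A_n$ ($n\ge2$), $\tilde D_n$ ($n\ge4$), $\tilde E_6,\tilde E_7,\tilde E_8$. The integral generalised Burau representation $\tilde\sigma:A[\Gamma]\to\mathrm{GL}(n,\mathbb{Z})$ of a small Coxeter graph is defined on the basis $e_1,\dots,e_n$ by $\tilde\sigma(a_i)(e_j)=e_j-\langle e_i,e_j\rangle e_i$, where $\langle e_i,e_j\rangle=-2\cos(\pi/m_{i,j})$ if $i<j$, $0$ if $i=j$, and $2\cos(\pi/m_{i,j})$ if $i>j$,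 with the convention $\pi/\infty=0$. For $m\ge2$, $A[\Gamma][m]$ is the kernel of $A[\Gamma]\xrightarrow{\tilde\sigma}\mathrm{GL}(n,\mathbb{Z})\to\mathrm{GL}(n,\mathbb{Z}/m)$. $A[\Gamma]$ admits the congruence subgroup property with respect to $\tilde\sigma$ if every finite index subgroup of $A[\Gamma]$ contains $A[\Gamma][m]$ for some $m\ge2$. *)

theory Defs
  imports
    "HOL-Library.Extended_Nat"
    "HOL-Algebra.Coset"
    "Jordan_Normal_Form.Matrix"
    Complex_Main
begin

section \<open>Group presentations\<close>

text \<open>
  A letter \<open>(x, True)\<close> stands for the generator \<open>x\<close> and \<open>(x, False)\<close> for its formal inverse.
\<close>

type_synonym 'a word = "('a \<times> bool) list"

abbreviation words :: "'a set \<Rightarrow> 'a word set"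
  where "words S \<equiv> lists (S \<times> UNIV)"

inductive pres_eq :: "'a set \<Rightarrow> ('a word \<times> 'a word) set \<Rightarrow> 'a word \<Rightarrow> 'a word \<Rightarrow> bool"
  for S R where
  pres_refl: "w \<in> words S \<Longrightarrow> pres_eq S R w w"
| pres_sym: "pres_eq S R v w \<Longrightarrow> pres_eq S R w v"
| pres_trans: "pres_eq S R u v \<Longrightarrow> pres_eq S R v w \<Longrightarrow> pres_eq S R u w"
| pres_cancel: "u \<in> words S \<Longrightarrow> v \<in> words S \<Longrightarrow> x \<in> S \<Longrightarrow>
    pres_eq S R (u @ [(x, b), (x, \<not> b)] @ v) (u @ v)"
| pres_relator: "u \<in> words S \<Longrightarrow> v \<in> words S \<Longrightarrow> (r, s) \<in> R \<Longrightarrow> r \<in> words S \<Longrightarrow> s \<in> words S \<Longrightarrow>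
    pres_eq S R (u @ r @ v) (u @ s @ v)"

definition pres_rel :: "'a set \<Rightarrow> ('a word \<times> 'a word) set \<Rightarrow> ('a word \<times> 'a word) set"
  where "pres_rel S R = {(v, w). pres_eq S R v w}"

text \<open>The group \<open>\<langle>S | r = s for (r, s) \<in> R\<rangle>\<close>.\<close>

definition presented_group :: "'a set \<Rightarrow> ('a word \<times> 'a word) set \<Rightarrow> 'a word set monoid"
  where "presented_group S R =
    \<lparr>carrier = words S // pres_rel S R,
     monoid.mult = (\<lambda>X Y. \<Union>v\<in>X. \<Union>w\<in>Y. pres_rel S R `` {v @ w}),
     one = pres_rel S R `` {[]}\<rparr>"

primrec word_eval :: "('g, 'b) monoid_scheme \<Rightarrow> ('a \<Rightarrow> 'g) \<Rightarrow> 'a word \<Rightarrow> 'g" where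
  "word_eval G f [] = \<one>\<^bsub>G\<^esub>"
| "word_eval G f (l # w) =
    (if snd l then f (fst l) else inv\<^bsub>G\<^esub> (f (fst l))) \<otimes>\<^bsub>G\<^esub> word_eval G f w"

text \<open>
  The map on a presented group induced by a map \<open>f\<close> on the generators. It is meaningful when
  \<open>f\<close> respects the relations: then \<open>word_eval G f\<close> is constant on each class.
\<close>

definition induced_map :: "('g, 'b) monoid_scheme \<Rightarrow> ('a \<Rightarrow> 'g) \<Rightarrow> 'a word set \<Rightarrow> 'g"
  where "induced_map G f X = the_elem (word_eval G f ` X)"

lemma pres_eq_words:
  assumes "pres_eq S R v w" shows "v \<in> words S \<and> w \<in> words S"
  using assms by induction auto

lemma pres_eq_context:
  assumes "pres_eq S R v w" "a \<in> words S" "b \<in> words S"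
  shows "pres_eq S R (a @ v @ b) (a @ w @ b)"
  using assms
proof (induction)
  case (pres_refl w) then show ?case by (auto intro!: pres_eq.pres_refl)
next
  case (pres_sym v w) then show ?case by (auto intro: pres_eq.pres_sym)
next
  case (pres_trans u v w) then show ?case by (auto intro: pres_eq.pres_trans)
next
  case (pres_cancel u v x c)
  then show ?case using pres_eq.pres_cancel[of "a @ u" S "v @ b" x R c] by auto
next
  case (pres_relator u v r s)
  then show ?case using pres_eq.pres_relator[of "a @ u" S "v @ b" r s R] by auto
qed

lemma pres_eq_append:
  assumes "pres_eq S R v v'" "pres_eq S R w w'"
  shows "pres_eq S R (v @ w) (v' @ w')"
  using pres_eq_context[OF assms(1), of "[]" w] pres_eq_context[OF assms(2), of v' "[]"]
    pres_eq_words[OF assms(1)] pres_eq_words[OF assms(2)]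
  by (auto intro: pres_eq.pres_trans)

lemma equiv_pres_rel: "equiv (words S) (pres_rel S R)"
proof (rule equivI)
  show "pres_rel S R \<subseteq> words S \<times> words S"
    by (rule subrelI, unfold pres_rel_def mem_Collect_eq prod.case mem_Sigma_iff, rule pres_eq_words)
qed (auto simp: pres_rel_def refl_on_def sym_def trans_def
       intro: pres_eq.pres_refl pres_eq.pres_sym pres_eq.pres_trans)

lemma presented_group_mult:
  assumes "v \<in> words S" "w \<in> words S"
  shows "pres_rel S R `` {v} \<otimes>\<^bsub>presented_group S R\<^esub> pres_rel S R `` {w} = pres_rel S R `` {v @ w}"
proof -
  let ?c = "\<lambda>w. pres_rel S R `` {w}"
  have eq: "?c (v' @ w') = ?c (v @ w)" if "v' \<in> ?c v" "w' \<in> ?c w" for v' w'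
  proof -
    have "pres_eq S R v v'" "pres_eq S R w w'" using that by (simp_all add: pres_rel_def)
    then have "(v @ w, v' @ w') \<in> pres_rel S R" by (simp add: pres_rel_def pres_eq_append)
    then show ?thesis by (rule equiv_class_eq[OF equiv_pres_rel, symmetric])
  qed
  have mem: "v \<in> ?c v" "w \<in> ?c w"
    using assms by (simp_all add: pres_rel_def pres_eq.pres_refl del: in_lists_conv_set)
  have "(\<Union>v'\<in>?c v. \<Union>w'\<in>?c w. ?c (v' @ w')) = (\<Union>v'\<in>?c v. \<Union>w'\<in>?c w. ?c (v @ w))"
    by (intro SUP_cong HOL.refl eq)
  also have "\<dots> = ?c (v @ w)" using mem by (simp only: UN_constant) auto
  finally show ?thesis by (simp add: presented_group_def)
qed

definition word_inv :: "'a word \<Rightarrow> 'a word"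
  where "word_inv w = rev (map (\<lambda>(x, b). (x, \<not> b)) w)"

lemma word_inv_words: "w \<in> words S \<Longrightarrow> word_inv w \<in> words S"
  by (auto simp: word_inv_def)

lemma pres_eq_inv_left:
  assumes "w \<in> words S" shows "pres_eq S R (word_inv w @ w) []"
  using assms
proof (induction w)
  case Nil then show ?case by (auto simp: word_inv_def intro: pres_eq.pres_refl)
next
  case (Cons l w)
  obtain x b where l: "l = (x, b)" by (cases l)
  have "pres_eq S R (word_inv w @ [(x, \<not> b), (x, \<not> \<not> b)] @ w) (word_inv w @ w)"
    using Cons l word_inv_words[of w S] by (intro pres_eq.pres_cancel) auto
  then show ?case using Cons l by (auto simp: word_inv_def intro: pres_eq.pres_trans)
qed

lemma carrier_presented_group:
  "carrier (presented_group S R) = (\<lambda>w. pres_rel S R `` {w}) ` words S"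
  by (auto simp: presented_group_def quotient_def)

lemma presented_group_one: "\<one>\<^bsub>presented_group S R\<^esub> = pres_rel S R `` {[]}"
  by (simp add: presented_group_def)

lemma group_presented_group: "group (presented_group S R)"
proof (rule groupI, goal_cases)
  case (1 X Y)
  then show ?case
    unfolding carrier_presented_group
    by (elim imageE, hypsubst, subst presented_group_mult)
      (assumption, assumption, intro imageI, simp)
next
  case 2
  show ?case unfolding carrier_presented_group presented_group_one by (intro imageI) simp
next
  case (3 X Y Z)
  then show ?case
    unfolding carrier_presented_group
    by (elim imageE) (simp add: presented_group_mult del: in_lists_conv_set)
next
  case (4 X)
  then show ?case
    unfolding carrier_presented_group presented_group_one
    by (elim imageE) (simp add: presented_group_mult del: in_lists_conv_set)
next
  case (5 X)
  then obtain v where v: "v \<in> words S" "X = pres_rel S R `` {v}"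
    unfolding carrier_presented_group by (elim imageE)
  have "(word_inv v @ v, []) \<in> pres_rel S R"
    using pres_eq_inv_left[OF v(1)] by (simp add: pres_rel_def)
  then have "pres_rel S R `` {word_inv v @ v} = pres_rel S R `` {[]}"
    by (rule equiv_class_eq[OF equiv_pres_rel])
  then have "pres_rel S R `` {word_inv v} \<otimes>\<^bsub>presented_group S R\<^esub> X = \<one>\<^bsub>presented_group S R\<^esub>"
    unfolding v(2) presented_group_one
    by (subst presented_group_mult[OF word_inv_words[OF v(1)] v(1)])
  moreover have "pres_rel S R `` {word_inv v} \<in> carrier (presented_group S R)"
    unfolding carrier_presented_group by (rule imageI[OF word_inv_words[OF v(1)]])
  ultimately show ?case by (rule bexI)
qed

context group
begin

lemma word_eval_closed:
  assumes "f \<in> S \<rightarrow> carrier G" "w \<in> words S" shows "word_eval G f w \<in> carrier G"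
  using assms(2,1) by (induction w) (auto simp: Pi_def)

lemma word_eval_append:
  assumes "f \<in> S \<rightarrow> carrier G" "v \<in> words S" "w \<in> words S"
  shows "word_eval G f (v @ w) = word_eval G f v \<otimes> word_eval G f w"
  using assms(2,1,3)
proof (induction v)
  case Nil then show ?case by (simp add: word_eval_closed)
next
  case (Cons l v)
  then have "f (fst l) \<in> carrier G" by auto
  with Cons word_eval_closed[of f S] show ?case by (auto simp: m_assoc)
qed

lemma word_eval_pres_eq:
  assumes f: "f \<in> S \<rightarrow> carrier G"
    and R: "\<And>r s. (r, s) \<in> R \<Longrightarrow> word_eval G f r = word_eval G f s"
    and "pres_eq S R v w"
  shows "word_eval G f v = word_eval G f w"
  using assms(3)
proof induction
  case (pres_cancel u v x b)
  then have x: "f x \<in> carrier G" using f by auto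
  have "word_eval G f [(x, b), (x, \<not> b)] = \<one>" using x by (cases b) auto
  then have "word_eval G f ([(x, b), (x, \<not> b)] @ v) = word_eval G f v"
    using pres_cancel f word_eval_append[of f S "[(x, b), (x, \<not> b)]" v] word_eval_closed[of f S v] by simp
  then show ?case
    using pres_cancel f word_eval_append[of f S u v]
      word_eval_append[of f S u "[(x, b), (x, \<not> b)] @ v"] by simp
next
  case (pres_relator u v r s)
  then show ?case
    using f R[of r s] word_eval_append[of f S u "r @ v"] word_eval_append[of f S r v]
      word_eval_append[of f S u "s @ v"] word_eval_append[of f S s v] by simp
qed auto

lemma induced_map_class:
  assumes f: "f \<in> S \<rightarrow> carrier G"
    and R: "\<And>r s. (r, s) \<in> R \<Longrightarrow> word_eval G f r = word_eval G f s"
    and w: "w \<in> words S"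
  shows "induced_map G f (pres_rel S R `` {w}) = word_eval G f w"
proof -
  let ?X = "pres_rel S R `` {w}"
  have mem: "w \<in> ?X"
    using pres_eq.pres_refl[OF w, of R] by (simp add: pres_rel_def)
  have const: "word_eval G f v = word_eval G f w" if "v \<in> ?X" for v
  proof -
    have "pres_eq S R w v" using that by (simp add: pres_rel_def)
    from word_eval_pres_eq[OF f _ this] R show ?thesis by metis
  qed
  have "word_eval G f ` ?X = (\<lambda>_. word_eval G f w) ` ?X"
    using const by (rule image_cong[OF HOL.refl])
  also have "\<dots> = {word_eval G f w}"
    using mem by (rule image_constant)
  finally show ?thesis by (simp add: induced_map_def)
qed

lemma induced_map_hom:
  assumes f: "f \<in> S \<rightarrow> carrier G"
    and R: "\<And>r s. (r, s) \<in> R \<Longrightarrow> word_eval G f r = word_eval G f s"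
  shows "induced_map G f \<in> hom (presented_group S R) G"
proof (rule homI)
  fix X assume "X \<in> carrier (presented_group S R)"
  then obtain v where v: "v \<in> words S" "X = pres_rel S R `` {v}"
    unfolding carrier_presented_group by (elim imageE)
  then show "induced_map G f X \<in> carrier G"
    using word_eval_closed[OF f v(1)] by (simp only: induced_map_class[OF f R])
  fix Y assume "Y \<in> carrier (presented_group S R)"
  then obtain w where w: "w \<in> words S" "Y = pres_rel S R `` {w}"
    unfolding carrier_presented_group by (elim imageE)
  have vw: "v @ w \<in> words S" using v w by simp
  show "induced_map G f (X \<otimes>\<^bsub>presented_group S R\<^esub> Y) = induced_map G f X \<otimes> induced_map G f Y"
    unfolding v(2) w(2) presented_group_mult[OF v(1) w(1)]
    using word_eval_append[OF f v(1) w(1)]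
    by (simp only: induced_map_class[OF f R] v(1) w(1) vw)
qed

end


section \<open>Coxeter matrices, Coxeter graphs and Artin groups\<close>

text \<open>
  The vertices \<open>1, \<dots>, n\<close> are renumbered as \<open>0, \<dots>, n - 1\<close>, in the same order. Entries of a Coxeter
  matrix outside this range are irrelevant.
\<close>

definition coxeter_matrix :: "nat \<Rightarrow> (nat \<Rightarrow> nat \<Rightarrow> enat) \<Rightarrow> bool"
  where "coxeter_matrix n m \<longleftrightarrow>
    (\<forall>i<n. m i i = 1) \<and> (\<forall>i<n. \<forall>j<n. i \<noteq> j \<longrightarrow> m i j = m j i \<and> m i j \<ge> 2)"

definition small_coxeter :: "nat \<Rightarrow> (nat \<Rightarrow> nat \<Rightarrow> enat) \<Rightarrow> bool"
  where "small_coxeter n m \<longleftrightarrow> (\<forall>i<n. \<forall>j<n. m i j \<in> {1, 2, 3, \<infinity>})"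

definition coxeter_edges :: "nat \<Rightarrow> (nat \<Rightarrow> nat \<Rightarrow> enat) \<Rightarrow> (nat \<times> nat) set"
  where "coxeter_edges n m = {(i, j). i < n \<and> j < n \<and> i \<noteq> j \<and> m i j \<ge> 3}"

definition coxeter_components :: "nat \<Rightarrow> (nat \<Rightarrow> nat \<Rightarrow> enat) \<Rightarrow> nat set set"
  where "coxeter_components n m = {(coxeter_edges n m)\<^sup>* `` {i} | i. i < n}"

text \<open>The Coxeter matrix whose Coxeter graph has the given unlabelled edges.\<close>

definition unlabelled_coxeter :: "nat set set \<Rightarrow> nat \<Rightarrow> nat \<Rightarrow> enat"
  where "unlabelled_coxeter E i j = (if i = j then 1 else if {i, j} \<in> E then 3 else 2)"

definition affine_A1 :: "nat \<Rightarrow> nat \<Rightarrow> enat"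
  where "affine_A1 i j = (if i = j then 1 else \<infinity>)"

text \<open>The cycle on the \<open>k + 1\<close> vertices \<open>0, \<dots>, k\<close>.\<close>

definition affine_A :: "nat \<Rightarrow> nat \<Rightarrow> nat \<Rightarrow> enat"
  where "affine_A k = unlabelled_coxeter ({{i, i + 1} | i. i < k} \<union> {{0, k}})"

text \<open>
  The path \<open>1 - 2 - \<dots> - (k - 1)\<close> with two further leaves: \<open>0\<close>, attached to \<open>2\<close>, and \<open>k\<close>,
  attached to \<open>k - 2\<close>.
\<close>

definition affine_D :: "nat \<Rightarrow> nat \<Rightarrow> nat \<Rightarrow> enat"
  where "affine_D k =
    unlabelled_coxeter ({{i, i + 1} | i. 1 \<le> i \<and> i < k - 1} \<union> {{0, 2}, {k - 2, k}})"

text \<open>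
  Trees with one trivalent vertex and arms of lengths \<open>2, 2, 2\<close>, \<open>3, 3, 1\<close> and \<open>2, 5, 1\<close>.
\<close>

definition affine_E6 :: "nat \<Rightarrow> nat \<Rightarrow> enat"
  where "affine_E6 = unlabelled_coxeter ({{i, i + 1} | i. i < 4} \<union> {{2, 5}, {5, 6}})"

definition affine_E7 :: "nat \<Rightarrow> nat \<Rightarrow> enat"
  where "affine_E7 = unlabelled_coxeter ({{i, i + 1} | i. i < 6} \<union> {{3, 7}})"

definition affine_E8 :: "nat \<Rightarrow> nat \<Rightarrow> enat"
  where "affine_E8 = unlabelled_coxeter ({{i, i + 1} | i. i < 7} \<union> {{2, 8}})"

text \<open>Pairs of a number of vertices and a Coxeter matrix.\<close>

definition affine_coxeter_list :: "(nat \<times> (nat \<Rightarrow> nat \<Rightarrow> enat)) set"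
  where "affine_coxeter_list =
    {(2, affine_A1)} \<union> {(k + 1, affine_A k) | k. k \<ge> 2} \<union> {(k + 1, affine_D k) | k. k \<ge> 4} \<union>
    {(7, affine_E6), (8, affine_E7), (9, affine_E8)}"

text \<open>
  The full labelled subgraph on \<open>C\<close> is isomorphic to one of the affine Coxeter graphs. A Coxeter
  matrix and its labelled graph determine each other, so isomorphisms are the bijections that
  preserve the matrix entries.
\<close>

definition affine_component :: "(nat \<Rightarrow> nat \<Rightarrow> enat) \<Rightarrow> nat set \<Rightarrow> bool"
  where "affine_component m C \<longleftrightarrow>
    (\<exists>(k, a) \<in> affine_coxeter_list. \<exists>\<phi>. bij_betw \<phi> C {..<k} \<and>
      (\<forall>i\<in>C. \<forall>j\<in>C. m i j = a (\<phi> i) (\<phi> j)))"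

fun alternating :: "nat \<Rightarrow> nat \<Rightarrow> nat \<Rightarrow> nat word" where
  "alternating i j 0 = []"
| "alternating i j (Suc k) = (i, True) # alternating j i k"

definition artin_relations :: "nat \<Rightarrow> (nat \<Rightarrow> nat \<Rightarrow> enat) \<Rightarrow> (nat word \<times> nat word) set"
  where "artin_relations n m =
    {(alternating i j k, alternating j i k) | i j k. i < n \<and> j < n \<and> i \<noteq> j \<and> m i j = enat k}"

definition artin_group :: "nat \<Rightarrow> (nat \<Rightarrow> nat \<Rightarrow> enat) \<Rightarrow> nat word set monoid"
  where "artin_group n m = presented_group {..<n} (artin_relations n m)"

definition artin_gen :: "nat \<Rightarrow> (nat \<Rightarrow> nat \<Rightarrow> enat) \<Rightarrow> nat \<Rightarrow> nat word set"
  where "artin_gen n m i = pres_rel {..<n} (artin_relations n m) `` {[(i, True)]}"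


section \<open>The integral generalised Burau representation\<close>

fun pi_over :: "enat \<Rightarrow> real" where
  "pi_over (enat k) = pi / real k"
| "pi_over \<infinity> = 0"

definition burau_form :: "(nat \<Rightarrow> nat \<Rightarrow> enat) \<Rightarrow> nat \<Rightarrow> nat \<Rightarrow> real"
  where "burau_form m i j =
    (if i < j then - 2 * cos (pi_over (m i j)) else if i = j then 0 else 2 * cos (pi_over (m i j)))"

text \<open>For a small Coxeter matrix the form is integral, and the floor only changes the type.\<close>

definition burau_form_int :: "(nat \<Rightarrow> nat \<Rightarrow> enat) \<Rightarrow> nat \<Rightarrow> nat \<Rightarrow> int"
  where "burau_form_int m i j = \<lfloor>burau_form m i j\<rfloor>"

lemma burau_form_values:
  assumes "coxeter_matrix n m" "small_coxeter n m" "i < n" "j < n" "i \<noteq> j"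
  shows "m i j = 2 \<and> burau_form m i j = 0 \<or>
    m i j = 3 \<and> burau_form m i j = (if i < j then - 1 else 1) \<or>
    m i j = \<infinity> \<and> burau_form m i j = (if i < j then - 2 else 2)"
proof -
  have "m i j \<in> {1, 2, 3, \<infinity>}" "m i j \<ge> 2"
    using assms by (auto simp: coxeter_matrix_def small_coxeter_def)
  then consider "m i j = enat 2" | "m i j = enat 3" | "m i j = \<infinity>"
    by (auto simp: numeral_eq_enat one_enat_def)
  then show ?thesis
    using assms(5) by cases (auto simp: burau_form_def cos_60 numeral_eq_enat)
qed

lemma of_int_burau_form_int:
  assumes "coxeter_matrix n m" "small_coxeter n m" "i < n" "j < n"
  shows "real_of_int (burau_form_int m i j) = burau_form m i j"
proof (cases "i = j")
  case True then show ?thesis by (simp add: burau_form_int_def burau_form_def)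
next
  case False
  then have "burau_form m i j \<in> real_of_int ` {- 2, - 1, 0, 1, 2}"
    using burau_form_values[OF assms False] by (auto split: if_splits)
  then obtain z where "burau_form m i j = real_of_int z" by (elim imageE)
  then show ?thesis by (simp add: burau_form_int_def)
qed

definition GL_int :: "nat \<Rightarrow> int mat monoid"
  where "GL_int n = units_of (ring_mat TYPE(int) n ())"

text \<open>Column \<open>j\<close> of the matrix is the vector \<open>e\<^sub>j - \<langle>e\<^sub>i, e\<^sub>j\<rangle> e\<^sub>i\<close>.\<close>

definition burau_gen :: "nat \<Rightarrow> (nat \<Rightarrow> nat \<Rightarrow> enat) \<Rightarrow> nat \<Rightarrow> int mat"
  where "burau_gen n m i =
    mat_of_cols n (map (\<lambda>j. unit_vec n j - burau_form_int m i j \<cdot>\<^sub>v unit_vec n i) [0..<n])"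

definition burau :: "nat \<Rightarrow> (nat \<Rightarrow> nat \<Rightarrow> enat) \<Rightarrow> nat word set \<Rightarrow> int mat"
  where "burau n m = induced_map (GL_int n) (burau_gen n m)"

lemma group_GL_int: "group (GL_int n)"
proof -
  interpret ring "ring_mat TYPE(int) n ()" by (rule ring_mat)
  show ?thesis unfolding GL_int_def by (rule units_group)
qed

definition transvection :: "nat \<Rightarrow> nat \<Rightarrow> (nat \<Rightarrow> int) \<Rightarrow> int mat"
  where "transvection n i b =
    mat n n (\<lambda>(k, j). (if k = j then 1 else 0) - (if k = i then b j else 0))"

lemma burau_gen_transvection:
  assumes "i < n"
  shows "burau_gen n m i = transvection n i (burau_form_int m i)"
  by (rule eq_matI) (use assms in \<open>auto simp: burau_gen_def transvection_def mat_of_cols_def\<close>)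

definition row_form :: "nat \<Rightarrow> (nat \<Rightarrow> int) \<Rightarrow> int mat \<Rightarrow> nat \<Rightarrow> int"
  where "row_form n b A l = (\<Sum>j<n. b j * A $$ (j, l))"

lemma transvection_mult_entry:
  assumes "A \<in> carrier_mat n n" "k < n" "l < n"
  shows "(transvection n i b * A) $$ (k, l) =
    A $$ (k, l) - (if k = i then row_form n b A l else 0)"
proof -
  have "(transvection n i b * A) $$ (k, l) =
    (\<Sum>j<n. ((if k = j then 1 else 0) - (if k = i then b j else 0)) * A $$ (j, l))"
    using assms by (simp add: transvection_def scalar_prod_def lessThan_atLeast0)
  also have "\<dots> = (\<Sum>j<n. (if k = j then A $$ (j, l) else 0)) -
      (\<Sum>j<n. if k = i then b j * A $$ (j, l) else 0)"
    by (subst sum_subtractf [symmetric]) (rule sum.cong, auto simp: algebra_simps)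
  also have "\<dots> = A $$ (k, l) - (if k = i then row_form n b A l else 0)"
    using assms by (auto simp: row_form_def)
  finally show ?thesis .
qed

lemma transvection_carrier [simp]: "transvection n i b \<in> carrier_mat n n"
  by (simp add: transvection_def)

lemma transvection_mult_carrier [simp]:
  "A \<in> carrier_mat n n \<Longrightarrow> transvection n i b * A \<in> carrier_mat n n"
  by (rule mult_carrier_mat[OF transvection_carrier])

lemma row_form_transvection:
  assumes "A \<in> carrier_mat n n" "i < n" "l < n"
  shows "row_form n c (transvection n i b * A) l = row_form n c A l - c i * row_form n b A l"
proof -
  have "row_form n c (transvection n i b * A) l =
    (\<Sum>j<n. c j * A $$ (j, l) - (if j = i then c j * row_form n b A l else 0))"
    unfolding row_form_def [of n c]
    using assms by (intro sum.cong) (auto simp: transvection_mult_entry algebra_simps)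
  also have "\<dots> = row_form n c A l - c i * row_form n b A l"
    unfolding sum_subtractf row_form_def [of n c] using assms by simp
  finally show ?thesis .
qed

lemma transvection_entry:
  "k < n \<Longrightarrow> j < n \<Longrightarrow>
    transvection n i b $$ (k, j) = (if k = j then 1 else 0) - (if k = i then b j else 0)"
  by (simp add: transvection_def)

lemma transvection_inverse:
  assumes "i < n" "b i = 0"
  shows "transvection n i b * transvection n i (\<lambda>j. - b j) = 1\<^sub>m n"
proof (rule eq_matI)
  fix k l assume kl: "k < dim_row (1\<^sub>m n :: int mat)" "l < dim_col (1\<^sub>m n :: int mat)"
  have "row_form n b (transvection n i (\<lambda>j. - b j)) l = b l"
  proof -
    have "row_form n b (transvection n i (\<lambda>j. - b j) * 1\<^sub>m n) l =
        row_form n b (1\<^sub>m n) l - b i * row_form n (\<lambda>j. - b j) (1\<^sub>m n) l"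
      using assms kl by (intro row_form_transvection) auto
    moreover have "row_form n b (1\<^sub>m n) l = b l"
    proof -
      have "row_form n b (1\<^sub>m n) l = (\<Sum>j<n. if j = l then b j else 0)"
        unfolding row_form_def using kl by (intro sum.cong) auto
      then show ?thesis using kl by simp
    qed
    ultimately show ?thesis using assms by (simp add: right_mult_one_mat[OF transvection_carrier])
  qed
  then show "(transvection n i b * transvection n i (\<lambda>j. - b j)) $$ (k, l) = 1\<^sub>m n $$ (k, l)"
    using kl by (simp add: transvection_mult_entry transvection_entry del: index_mult_mat(1))
qed (auto simp: transvection_def)

lemma transvection_commute:
  assumes "i < n" "j < n" "b j = 0" "c i = 0"
  shows "transvection n i b * transvection n j c = transvection n j c * transvection n i b"
proof -
  have d: "dim_row (transvection n i b) = n" "dim_row (transvection n j c) = n"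
    by (simp_all add: transvection_def)
  have "transvection n i b * (transvection n j c * 1\<^sub>m n) =
    transvection n j c * (transvection n i b * 1\<^sub>m n)"
    by (rule eq_matI)
      (use assms in \<open>auto simp: d transvection_mult_entry row_form_transvection
         simp del: index_mult_mat(1)\<close>)
  then show ?thesis by (simp add: right_mult_one_mat[OF transvection_carrier])
qed

lemma transvection_braid:
  assumes "i < n" "j < n" "b i = 0" "c j = 0" "b j * c i = - 1"
  shows "transvection n i b * (transvection n j c * transvection n i b) =
    transvection n j c * (transvection n i b * transvection n j c)"
proof -
  have d: "dim_row (transvection n i b) = n" "dim_row (transvection n j c) = n"
    by (simp_all add: transvection_def)
  have e: "b j * (c i * x) = - x" "c i * (b j * x) = - x" for x
  proof -
    have "b j * (c i * x) = (b j * c i) * x" "c i * (b j * x) = (b j * c i) * x"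
      by (simp_all only: ac_simps)
    then show "b j * (c i * x) = - x" "c i * (b j * x) = - x" using assms(5) by simp_all
  qed
  have "transvection n i b * (transvection n j c * (transvection n i b * 1\<^sub>m n)) =
    transvection n j c * (transvection n i b * (transvection n j c * 1\<^sub>m n))"
  proof (rule eq_matI, goal_cases)
    case (1 k l)
    then have "k < n" "l < n" by (simp_all add: d)
    moreover have "i \<noteq> j" using assms(3,5) by auto
    ultimately show ?case using assms(1-4)
      by (simp add: transvection_mult_entry row_form_transvection right_diff_distrib e
          del: index_mult_mat(1))
  qed (simp_all add: d)
  then show ?thesis by (simp add: right_mult_one_mat[OF transvection_carrier])
qed

lemma burau_gen_GL:
  assumes "i < n" shows "burau_gen n m i \<in> carrier (GL_int n)"
proof -
  let ?b = "burau_form_int m i"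
  have 0: "?b i = 0" by (simp add: burau_form_int_def burau_form_def)
  have "transvection n i ?b * transvection n i (\<lambda>j. - ?b j) = 1\<^sub>m n"
    "transvection n i (\<lambda>j. - ?b j) * transvection n i ?b = 1\<^sub>m n"
    using transvection_inverse[of i n ?b] transvection_inverse[of i n "\<lambda>j. - ?b j"] assms 0 by auto
  then have "transvection n i ?b \<in> Units (ring_mat TYPE(int) n ())"
    unfolding Units_def ring_mat_simps using transvection_carrier by blast
  then show ?thesis by (simp add: GL_int_def units_of_carrier burau_gen_transvection[OF assms])
qed

lemma burau_gen_relations:
  assumes "coxeter_matrix n m" "small_coxeter n m" "(r, s) \<in> artin_relations n m"
  shows "word_eval (GL_int n) (burau_gen n m) r = word_eval (GL_int n) (burau_gen n m) s"
proof -
  obtain i j k where ij: "r = alternating i j k" "s = alternating j i k" "i < n" "j < n" "i \<noteq> j"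
    "m i j = enat k" using assms(3) by (auto simp: artin_relations_def)
  let ?B = "burau_form_int m" and ?T = "\<lambda>i. transvection n i (burau_form_int m i)"
  have mult: "x \<otimes>\<^bsub>GL_int n\<^esub> y = x * y" "\<one>\<^bsub>GL_int n\<^esub> = 1\<^sub>m n" for x y
    by (simp_all add: GL_int_def units_of_mult units_of_one ring_mat_simps)
  have sym: "m j i = m i j" using assms(1) ij by (auto simp: coxeter_matrix_def)
  have B0: "?B i i = 0" for i by (simp add: burau_form_int_def burau_form_def)
  have v: "m i j = 2 \<and> burau_form m i j = 0 \<or>
      m i j = 3 \<and> burau_form m i j = (if i < j then - 1 else 1) \<or> m i j = \<infinity>"
    using burau_form_values[OF assms(1,2) ij(3,4,5)] by auto
  have w: "m i j = 2 \<and> burau_form m j i = 0 \<or>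
      m i j = 3 \<and> burau_form m j i = (if j < i then - 1 else 1) \<or> m i j = \<infinity>"
    using burau_form_values[OF assms(1,2) ij(4,3) ij(5) [symmetric]] sym by auto
  have floor_m1: "\<lfloor>- 1 :: real\<rfloor> = - 1" by (simp add: floor_eq_iff)
  consider "k = 2" "?B i j = 0" "?B j i = 0" | "k = 3" "?B i j * ?B j i = - 1"
    using v w ij(5,6)
    by (cases i j rule: linorder_cases) (auto simp: burau_form_int_def numeral_eq_enat floor_m1)
  then show ?thesis
  proof cases
    case 1
    then show ?thesis
      using transvection_commute[of i n j "?B i" "?B j"] ij
      by (simp add: numeral_2_eq_2 mult burau_gen_transvection
          right_mult_one_mat[OF transvection_carrier])
  next
    case 2
    then show ?thesis
      using transvection_braid[of i n j "?B i" "?B j"] ij B0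
      by (simp add: numeral_3_eq_3 mult burau_gen_transvection
          right_mult_one_mat[OF transvection_carrier])
  qed
qed

lemma burau_hom:
  assumes "coxeter_matrix n m" "small_coxeter n m"
  shows "burau n m \<in> hom (artin_group n m) (GL_int n)"
  unfolding burau_def artin_group_def
  using burau_gen_GL burau_gen_relations[OF assms]
  by (intro group.induced_map_hom[OF group_GL_int]) auto

lemma burau_artin_gen:
  assumes "coxeter_matrix n m" "small_coxeter n m" "i < n"
  shows "burau n m (artin_gen n m i) = burau_gen n m i"
proof -
  have "burau n m (artin_gen n m i) = word_eval (GL_int n) (burau_gen n m) [(i, True)]"
    unfolding burau_def artin_gen_def
    using assms(3) burau_gen_GL burau_gen_relations[OF assms(1,2)]
    by (intro group.induced_map_class[OF group_GL_int]) auto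
  then show ?thesis
    using group.is_monoid[OF group_GL_int] burau_gen_GL[OF assms(3), of m]
    by (simp add: monoid.r_one)
qed


section \<open>Congruence subgroups\<close>

text \<open>Matrices over \<open>\<int>/d\<close> are integer matrices with entries in \<open>{0..<d}\<close>, multiplied modulo \<open>d\<close>.\<close>

definition reduce_mat :: "nat \<Rightarrow> int mat \<Rightarrow> int mat"
  where "reduce_mat d = map_mat (\<lambda>a. a mod int d)"

definition mat_mod :: "nat \<Rightarrow> nat \<Rightarrow> int mat monoid"
  where "mat_mod n d =
    \<lparr>carrier = {A \<in> carrier_mat n n. elements_mat A \<subseteq> {0..<int d}},
     monoid.mult = (\<lambda>A B. reduce_mat d (A * B)),
     one = reduce_mat d (1\<^sub>m n)\<rparr>"

definition GL_mod :: "nat \<Rightarrow> nat \<Rightarrow> int mat monoid"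
  where "GL_mod n d = units_of (mat_mod n d)"

definition congruence_subgroup :: "nat \<Rightarrow> (nat \<Rightarrow> nat \<Rightarrow> enat) \<Rightarrow> nat \<Rightarrow> nat word set set"
  where "congruence_subgroup n m d =
    kernel (artin_group n m) (GL_mod n d) (reduce_mat d \<circ> burau n m)"

definition congruence_subgroup_property :: "nat \<Rightarrow> (nat \<Rightarrow> nat \<Rightarrow> enat) \<Rightarrow> bool"
  where "congruence_subgroup_property n m \<longleftrightarrow>
    (\<forall>H. subgroup H (artin_group n m) \<and> finite (rcosets\<^bsub>artin_group n m\<^esub> H) \<longrightarrow>
      (\<exists>d\<ge>2. congruence_subgroup n m d \<subseteq> H))"

lemma reduce_mat_mult:
  assumes "A \<in> carrier_mat n n" "B \<in> carrier_mat n n"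
  shows "reduce_mat d (reduce_mat d A * reduce_mat d B) = reduce_mat d (A * B)"
proof (rule eq_matI)
  fix i j assume "i < dim_row (reduce_mat d (A * B))" "j < dim_col (reduce_mat d (A * B))"
  then have ij: "i < n" "j < n" using assms by (auto simp: reduce_mat_def)
  have "(\<Sum>k<n. (A $$ (i, k) mod int d) * (B $$ (k, j) mod int d)) mod int d =
      (\<Sum>k<n. A $$ (i, k) * B $$ (k, j)) mod int d"
    by (subst mod_sum_eq [symmetric], subst (2) mod_sum_eq [symmetric]) (simp add: mod_mult_eq)
  then show "reduce_mat d (reduce_mat d A * reduce_mat d B) $$ (i, j) = reduce_mat d (A * B) $$ (i, j)"
    using ij assms by (simp add: reduce_mat_def scalar_prod_def lessThan_atLeast0)
qed (use assms in \<open>auto simp: reduce_mat_def\<close>)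

lemma reduce_mat_hom:
  assumes "d > 0"
  shows "reduce_mat d \<in> hom (GL_int n) (GL_mod n d)"
proof (rule homI)
  have cl: "reduce_mat d A \<in> carrier (mat_mod n d)" if "A \<in> carrier_mat n n" for A
    using that assms by (auto simp: mat_mod_def reduce_mat_def elements_mat_def)
  have one: "\<one>\<^bsub>mat_mod n d\<^esub> = reduce_mat d (1\<^sub>m n)" by (simp add: mat_mod_def)
  have mult: "reduce_mat d A \<otimes>\<^bsub>mat_mod n d\<^esub> reduce_mat d B = reduce_mat d (A * B)"
    if "A \<in> carrier_mat n n" "B \<in> carrier_mat n n" for A B
    using reduce_mat_mult[OF that] by (simp add: mat_mod_def)
  show "reduce_mat d A \<in> carrier (GL_mod n d)" if A: "A \<in> carrier (GL_int n)" for A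
  proof -
    obtain B where "A \<in> carrier_mat n n" "B \<in> carrier_mat n n" "A * B = 1\<^sub>m n" "B * A = 1\<^sub>m n"
      using A by (auto simp: GL_int_def units_of_carrier Units_def ring_mat_simps)
    then show ?thesis
      using cl[of A] cl[of B] mult[of A B] mult[of B A]
      by (auto simp: GL_mod_def units_of_carrier Units_def one)
  qed
  show "reduce_mat d (A \<otimes>\<^bsub>GL_int n\<^esub> B) = reduce_mat d A \<otimes>\<^bsub>GL_mod n d\<^esub> reduce_mat d B"
    if "A \<in> carrier (GL_int n)" "B \<in> carrier (GL_int n)" for A B
    using that mult[of A B]
    by (auto simp: GL_int_def GL_mod_def units_of_carrier units_of_mult Units_def ring_mat_simps)
qed

end

theory Submission
  imports
    Defs
    "HOL-Algebra.Elementary_Groups"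
    "HOL-Number_Theory.Cong"
begin

text \<open>
  All relations of the Artin group preserve word length, so length modulo \<open>5\<close> is a homomorphism
  onto \<open>\<int>/5\<close>; its kernel has finite index but contains no congruence subgroup. If the vertex \<open>i\<close> is
  isolated, \<open>a\<^sub>i\<close> acts trivially and has length \<open>1\<close>. Otherwise \<open>i\<close> has a neighbour \<open>j\<close>, and
  \<open>\<langle>e\<^sub>i, e\<^sub>j\<rangle>\<close> is \<open>\<plusminus> 1\<close> or \<open>\<plusminus> 2\<close>, a unit modulo powers of \<open>5\<close>. Write \<open>d = 5\<^sup>s e\<close> with \<open>e\<close> prime to \<open>5\<close>.
  Some \<open>h\<close> in the subgroup generated by \<open>a\<^sub>i\<close> and \<open>a\<^sub>j\<close> maps \<open>e\<^sub>i\<close> to \<open>2 e\<^sub>i\<close> modulo \<open>5\<^sup>s\<close>, so it conjugates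
  the action of \<open>a\<^sub>i\<^sup>e\<close> to that of \<open>a\<^sub>i\<^sup>4\<^sup>e\<close> modulo \<open>5\<^sup>s\<close>, while both are trivial modulo \<open>e\<close>. Thus
  \<open>h a\<^sub>i\<^sup>e\<close> and \<open>a\<^sub>i\<^sup>4\<^sup>e h\<close> agree modulo \<open>d\<close>, but their lengths differ by \<open>3 e\<close>, which is nonzero modulo \<open>5\<close>.
\<close>

section \<open>Congruences and matrix entries of transvections\<close>

text \<open>The solution is taken in \<open>nat\<close> so that it can serve as an exponent of a
  generator.\<close>

lemma cong_solve_nat_multiple:
  fixes c r N :: int
  assumes "coprime c N" "N > 0"
  obtains k :: nat where "[c * int k = r] (mod N)"
proof -
  obtain u where u: "[c * u = 1] (mod N)" using cong_solve_coprime_int[OF assms(1)] by blast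
  have "[c * int (nat (u * r mod N)) = c * (u * r)] (mod N)"
    using assms(2) by (simp add: cong_def mod_mult_right_eq)
  also have "[c * (u * r) = r] (mod N)" using cong_scalar_right[OF u, of r] by (simp add: mult.assoc)
  finally show ?thesis by (rule that)
qed

lemma row_form_smult: "row_form n (\<lambda>j. r * b j) A l = r * row_form n b A l"
  by (simp add: row_form_def sum_distrib_left mult.assoc)

lemma row_form_one:
  assumes "l < n" shows "row_form n b (1\<^sub>m n) l = b l"
proof -
  have "row_form n b (1\<^sub>m n) l = (\<Sum>j<n. if j = l then b j else 0)"
    unfolding row_form_def using assms by (intro sum.cong) auto
  then show ?thesis using assms by simp
qed

lemma mult_transvection_entry:
  assumes "A \<in> carrier_mat n n" "i < n" "k < n" "l < n"
  shows "(A * transvection n i b) $$ (k, l) = A $$ (k, l) - A $$ (k, i) * b l"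
proof -
  have "(A * transvection n i b) $$ (k, l) =
    (\<Sum>j<n. A $$ (k, j) * ((if j = l then 1 else 0) - (if j = i then b l else 0)))"
    using assms by (simp add: transvection_def scalar_prod_def lessThan_atLeast0)
  also have "\<dots> = (\<Sum>j<n. (if j = l then A $$ (k, j) else 0)) -
      (\<Sum>j<n. if j = i then A $$ (k, j) * b l else 0)"
    by (subst sum_subtractf [symmetric]) (rule sum.cong, auto simp: algebra_simps)
  finally show ?thesis using assms by simp
qed

text \<open>Since \<open>b i = 0\<close>, the rank-one part squares to zero, so coefficients add.
  This is the induction step for powers of a Burau generator.\<close>

lemma transvection_add:
  assumes "i < n" "b i = 0"
  shows "transvection n i b * transvection n i (\<lambda>j. r * b j) = transvection n i (\<lambda>j. (1 + r) * b j)"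
proof (rule eq_matI, goal_cases)
  case (1 k l)
  then have kl: "k < n" "l < n" by (simp_all add: transvection_def)
  have "(transvection n i b * transvection n i (\<lambda>j. r * b j)) $$ (k, l) =
    transvection n i b $$ (k, l) - transvection n i b $$ (k, i) * (r * b l)"
    by (rule mult_transvection_entry) (use assms kl in auto)
  then show ?case using assms kl by (auto simp: transvection_entry algebra_simps)
qed (simp_all add: transvection_def)

text \<open>
  With \<open>c = \<langle>e\<^sub>j, e\<^sub>i\<rangle>\<close> invertible modulo \<open>N\<close>, the product \<open>P = T\<^sub>j\<^sup>z T\<^sub>i\<^sup>x T\<^sub>j\<^sup>y\<close> acts by
  \<open>e\<^sub>i \<mapsto> e\<^sub>i + e\<^sub>j \<mapsto> 2 e\<^sub>i + e\<^sub>j \<mapsto> 2 e\<^sub>i\<close> modulo \<open>N\<close>. Hence it conjugates \<open>T\<^sub>i\<close> to the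
  transvection along \<open>2 e\<^sub>i\<close>, which is \<open>T\<^sub>i\<^sup>4\<close>.
\<close>

lemma transvection_conj_cong:
  fixes b \<beta> :: "nat \<Rightarrow> int" and x y z c e N :: int
  assumes ij: "i < n" "j < n" "i \<noteq> j"
    and form: "b i = 0" "\<beta> j = 0" "b j = - c" "\<beta> i = c"
    and y: "[c * y = - 1] (mod N)" and x: "[c * x = 1] (mod N)" and z: "[2 * c * z = 1] (mod N)"
    and N: "coprime 2 N"
    and kl: "k < n" "l < n"
  defines "P \<equiv> transvection n j (\<lambda>l. z * \<beta> l) *
    (transvection n i (\<lambda>l. x * b l) * transvection n j (\<lambda>l. y * \<beta> l))"
  shows "[(P * transvection n i (\<lambda>l. e * b l)) $$ (k, l) =
    (transvection n i (\<lambda>l. 4 * e * b l) * P) $$ (k, l)] (mod N)"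
proof -
  have P: "P \<in> carrier_mat n n" unfolding P_def by simp
  have P': "P = transvection n j (\<lambda>l. z * \<beta> l) *
    (transvection n i (\<lambda>l. x * b l) * (transvection n j (\<lambda>l. y * \<beta> l) * 1\<^sub>m n))"
    unfolding P_def by (simp add: right_mult_one_mat[OF transvection_carrier])
  note entries = transvection_mult_entry row_form_transvection row_form_smult row_form_one
  \<comment> \<open>\<open>B\<close> is the value of \<open>b\<close> at the image of the
    \<open>l\<close>-th basis vector under the rightmost factor of \<open>P\<close>.\<close>
  define B where "B = b l + c * y * \<beta> l"
  \<comment> \<open>Everything is doubled because \<open>z\<close> inverts \<open>2 * c\<close>, not
    \<open>c\<close>. The result is that \<open>b\<close> is congruent to twice \<open>b\<close>
    composed with \<open>P\<close>.\<close>
  have row: "2 * row_form n b P l = 2 * B + 2 * c * z * (\<beta> l - c * x * B)"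
    unfolding P' B_def using ij kl form by (simp add: entries algebra_simps del: index_mult_mat(1))
  have B: "[B = b l - \<beta> l] (mod N)"
    using cong_add[OF cong_refl[of "b l"] cong_scalar_right[OF y, of "\<beta> l"]]
    by (simp add: B_def)
  have "[2 * row_form n b P l = 2 * (b l - \<beta> l) + 1 * (\<beta> l - 1 * (b l - \<beta> l))] (mod N)"
    unfolding row
    by (intro cong_add cong_mult cong_diff B x z cong_refl)
  then have row: "[2 * row_form n b P l = b l] (mod N)" by simp
  \<comment> \<open>Column \<open>i\<close> of \<open>P\<close> is the image of the
    \<open>i\<close>-th basis vector, here twice that vector.\<close>
  have col: "[P $$ (k, i) = (if k = i then 2 else 0)] (mod N)"
  proof -
    consider "k = i" | "k = j" | "k \<noteq> i" "k \<noteq> j" by blast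
    then show ?thesis
    proof cases
      case 1
      have "P $$ (k, i) = 1 - c * x * (c * y)"
        unfolding P' using ij kl form 1
        by (simp add: entries algebra_simps del: index_mult_mat(1))
      moreover have "[1 - c * x * (c * y) = 1 - 1 * (- 1)] (mod N)"
        by (intro cong_diff cong_mult x y cong_refl)
      ultimately show ?thesis using 1 by simp
    next
      case 2
      have eq: "2 * P $$ (k, i) = - 2 * (c * y) - 2 * c * z * (1 - c * x * (c * y))"
        unfolding P' using ij kl form 2
        by (simp add: entries algebra_simps del: index_mult_mat(1))
      have "[2 * P $$ (k, i) = - 2 * (- 1) - 1 * (1 - 1 * (- 1))] (mod N)"
        unfolding eq by (intro cong_diff cong_mult x y z cong_refl)
      then have "[2 * P $$ (k, i) = 2 * 0] (mod N)" by simp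
      then have "[P $$ (k, i) = 0] (mod N)" using N by (simp only: cong_mult_lcancel)
      then show ?thesis using 2 ij by simp
    next
      case 3
      then have "P $$ (k, i) = 0"
        unfolding P' using ij kl form by (simp add: entries del: index_mult_mat(1))
      then show ?thesis using 3 by simp
    qed
  qed
  \<comment> \<open>The factor 4 is a product of two 2s: one from \<open>col\<close>, the other from
    replacing \<open>b\<close> by its form through \<open>P\<close> using
    \<open>row\<close>.\<close>
  have "[P $$ (k, l) - P $$ (k, i) * (e * b l) =
      P $$ (k, l) - (if k = i then 2 else 0) * (e * b l)] (mod N)"
    by (intro cong_diff cong_mult col cong_refl)
  also have "(if k = i then 2 else 0) * (e * b l) = (if k = i then 2 * e * b l else 0)" by simp
  also have "[P $$ (k, l) - (if k = i then 2 * e * b l else 0) =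
      P $$ (k, l) - (if k = i then 2 * e * (2 * row_form n b P l) else 0)] (mod N)"
    using cong_mult[OF cong_refl[of "2 * e"] cong_sym[OF row]]
    by (intro cong_diff cong_refl) auto
  finally show ?thesis
    using P ij kl
    by (cases "k = i") (simp_all add: mult_transvection_entry transvection_mult_entry
        row_form_smult mult.assoc del: index_mult_mat(1))
qed

section \<open>Powers of Burau generators and equality of reductions\<close>

lemma GL_int_mult: "A \<otimes>\<^bsub>GL_int n\<^esub> B = A * B"
  by (simp add: GL_int_def units_of_mult ring_mat_simps)

lemma GL_int_one: "\<one>\<^bsub>GL_int n\<^esub> = 1\<^sub>m n"
  by (simp add: GL_int_def units_of_one ring_mat_simps)

lemma burau_gen_pow:
  assumes "i < n"
  shows "burau_gen n m i [^]\<^bsub>GL_int n\<^esub> (k :: nat) =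
    transvection n i (\<lambda>l. int k * burau_form_int m i l)"
proof (induction k)
  case 0
  show ?case by (rule eq_matI) (auto simp: transvection_def GL_int_one)
next
  case (Suc k)
  interpret group "GL_int n" by (rule group_GL_int)
  have "burau_form_int m i i = 0" by (simp add: burau_form_int_def burau_form_def)
  with Suc assms show ?case
    by (simp only: nat_pow_Suc2 burau_gen_GL)
      (simp add: GL_int_mult burau_gen_transvection transvection_add)
qed

lemma reduce_mat_eqI:
  assumes "A \<in> carrier_mat n n" "B \<in> carrier_mat n n"
    and "\<And>k l. k < n \<Longrightarrow> l < n \<Longrightarrow> [A $$ (k, l) = B $$ (k, l)] (mod int d)"
  shows "reduce_mat d A = reduce_mat d B"
  by (rule eq_matI) (use assms in \<open>auto simp: reduce_mat_def cong_def\<close>)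

section \<open>Exponent sum modulo 5\<close>

definition len_hom :: "nat word set \<Rightarrow> int"
  where "len_hom = induced_map (integer_mod_group 5) (\<lambda>_. 1)"

text \<open>When all generators have the same image, a positive word is evaluated by its length
  alone. Hence the Artin relations are respected.\<close>

lemma word_eval_alternating:
  "word_eval G (\<lambda>_. g) (alternating i j k) = word_eval G (\<lambda>_. g) (alternating i' j' k)"
proof (induction k arbitrary: i j i' j')
  case (Suc k)
  show ?case using Suc[of j i j' i'] by simp
qed simp

lemma len_hom: "len_hom \<in> hom (artin_group n m) (integer_mod_group 5)"
  unfolding len_hom_def artin_group_def
  by (intro group.induced_map_hom)
    (auto simp: carrier_integer_mod_group artin_relations_def intro: word_eval_alternating)

lemma len_hom_gen:
  assumes "i < n" shows "len_hom (artin_gen n m i) = 1"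
proof -
  have "len_hom (artin_gen n m i) = word_eval (integer_mod_group 5) (\<lambda>_. 1) [(i, True)]"
    unfolding len_hom_def artin_gen_def using assms
    by (intro group.induced_map_class[where S = "{..<n}"])
      (auto simp: carrier_integer_mod_group artin_relations_def intro: word_eval_alternating)
  then show ?thesis by simp
qed

lemma artin_gen_carrier: "i < n \<Longrightarrow> artin_gen n m i \<in> carrier (artin_group n m)"
  by (auto simp: artin_group_def artin_gen_def carrier_presented_group)

lemma group_artin_group: "group (artin_group n m)"
  unfolding artin_group_def by (rule group_presented_group)

text \<open>The quotient by the kernel embeds into the target.\<close>

lemma (in group_hom) finite_rcosets_kernel:
  assumes "finite (carrier H)" shows "finite (rcosets (kernel G H h))"
proof -
  have "finite (carrier (G Mod kernel G H h))"
    by (rule inj_on_finite[OF FactGroup_inj_on _ assms]) (use FactGroup_the_elem_mem in auto)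
  then show ?thesis by (simp add: FactGroup_def)
qed

section \<open>Refuting the congruence subgroup property\<close>

text \<open>The quotient of \<open>u\<close> by \<open>v\<close> lies in the congruence subgroup of
  level \<open>d\<close> but outside the finite-index kernel of \<open>len_hom\<close>.\<close>

lemma not_congruence_subgroup_propertyI:
  assumes "coxeter_matrix n m" "small_coxeter n m"
    and ex: "\<And>d. d \<ge> 2 \<Longrightarrow> \<exists>u\<in>carrier (artin_group n m). \<exists>v\<in>carrier (artin_group n m).
      reduce_mat d (burau n m u) = reduce_mat d (burau n m v) \<and> len_hom u \<noteq> len_hom v"
  shows "\<not> congruence_subgroup_property n m"
proof
  assume csp: "congruence_subgroup_property n m"
  let ?A = "artin_group n m"
  interpret A: group ?A by (rule group_artin_group)
  interpret L: group_hom ?A "integer_mod_group 5" len_hom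
    by (simp add: group_hom_def group_hom_axioms_def A.group_axioms len_hom)
  interpret B: group_hom ?A "GL_int n" "burau n m"
    by (simp add: group_hom_def group_hom_axioms_def A.group_axioms group_GL_int
        burau_hom[OF assms(1,2)])
  let ?H = "kernel ?A (integer_mod_group 5) len_hom"
  have "finite (rcosets\<^bsub>?A\<^esub> ?H)"
    by (rule L.finite_rcosets_kernel) (simp add: carrier_integer_mod_group)
  with csp L.subgroup_kernel obtain d where d: "d \<ge> 2" "congruence_subgroup n m d \<subseteq> ?H"
    unfolding congruence_subgroup_property_def by blast
  obtain u v where uv: "u \<in> carrier ?A" "v \<in> carrier ?A" "len_hom u \<noteq> len_hom v"
      "reduce_mat d (burau n m u) = reduce_mat d (burau n m v)"
    using ex[OF d(1)] by blast
  let ?w = "u \<otimes>\<^bsub>?A\<^esub> inv\<^bsub>?A\<^esub> v"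
  have M: "burau n m x \<in> carrier_mat n n" if "x \<in> carrier ?A" for x
    using B.hom_closed[OF that] by (auto simp: GL_int_def units_of_carrier Units_def ring_mat_simps)
  have hom: "burau n m (x \<otimes>\<^bsub>?A\<^esub> y) = burau n m x * burau n m y"
    if "x \<in> carrier ?A" "y \<in> carrier ?A" for x y
    using that by (simp add: GL_int_mult)
  \<comment> \<open>The reduction of a product depends only on the reductions of its factors, so
    \<open>u\<close> may be replaced by \<open>v\<close>.\<close>
  have "reduce_mat d (burau n m ?w) = reduce_mat d (burau n m (v \<otimes>\<^bsub>?A\<^esub> inv\<^bsub>?A\<^esub> v))"
    using uv A.inv_closed
    by (simp only: hom reduce_mat_mult[OF M M, symmetric] uv(4))
  also have "\<dots> = \<one>\<^bsub>GL_mod n d\<^esub>"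
    using uv(2) B.hom_one by (simp add: GL_int_one GL_mod_def units_of_one mat_mod_def)
  finally have "?w \<in> congruence_subgroup n m d"
    using uv by (simp add: congruence_subgroup_def kernel_def)
  with d have "len_hom ?w = 0" by (auto simp: kernel_def)
  then have "len_hom u \<otimes>\<^bsub>integer_mod_group 5\<^esub> inv\<^bsub>integer_mod_group 5\<^esub> len_hom v =
      \<one>\<^bsub>integer_mod_group 5\<^esub>"
    using uv(1,2) by (simp only: L.hom_mult L.hom_inv A.inv_closed one_integer_mod_group)
  then have "len_hom u = len_hom v"
    using uv(1,2) L.H.inv_equality[of "len_hom u" "inv\<^bsub>integer_mod_group 5\<^esub> len_hom v"]
    by (simp del: mult_integer_mod_group one_integer_mod_group inv_integer_mod_group)
  with uv(3) show False by simp
qed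

section \<open>Construction of the two elements for each modulus\<close>

theorem theorem5p8:
  fixes n :: nat and m :: "nat \<Rightarrow> nat \<Rightarrow> enat"
  assumes "coxeter_matrix n m"
    and "small_coxeter n m"
    and "\<exists>C \<in> coxeter_components n m. \<not> affine_component m C"
  shows "\<not> congruence_subgroup_property n m"
proof (rule not_congruence_subgroup_propertyI[OF assms(1,2)])
  fix d :: nat assume "d \<ge> 2"
  obtain i where i: "i < n" using assms(3) by (auto simp: coxeter_components_def)
  let ?A = "artin_group n m" and ?a = "artin_gen n m" and ?b = "burau_form_int m"
  let ?Z = "integer_mod_group 5"
  interpret A: group ?A by (rule group_artin_group)
  interpret L: group_hom ?A "?Z" len_hom
    by (simp add: group_hom_def group_hom_axioms_def A.group_axioms len_hom)
  interpret B: group_hom ?A "GL_int n" "burau n m"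
    by (simp add: group_hom_def group_hom_axioms_def A.group_axioms group_GL_int
        burau_hom[OF assms(1,2)])
  have pow: "burau n m (?a k [^]\<^bsub>?A\<^esub> r) = transvection n k (\<lambda>l. int r * ?b k l)"
    if "k < n" for k and r :: nat
    using that by (simp add: B.hom_nat_pow artin_gen_carrier burau_artin_gen[OF assms(1,2)]
        burau_gen_pow)
  note cl = artin_gen_carrier[of _ n m]
  show "\<exists>u\<in>carrier ?A. \<exists>v\<in>carrier ?A.
      reduce_mat d (burau n m u) = reduce_mat d (burau n m v) \<and> len_hom u \<noteq> len_hom v"
  proof (cases "\<forall>l<n. ?b i l = 0")
    case True
    then have "transvection n i (?b i) = 1\<^sub>m n"
      by (intro eq_matI) (auto simp: transvection_def)
    then have "burau n m (?a i) = burau n m \<one>\<^bsub>?A\<^esub>"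
      using i by (simp add: burau_artin_gen[OF assms(1,2)] burau_gen_transvection GL_int_one)
    moreover have "len_hom (?a i) \<noteq> len_hom \<one>\<^bsub>?A\<^esub>"
      using i by (simp add: len_hom_gen)
    ultimately show ?thesis using cl[OF i] by (metis A.one_closed)
  next
    case False
    have diag: "?b k k = 0" for k by (simp add: burau_form_int_def burau_form_def)
    obtain j where j: "j < n" "?b i j \<noteq> 0" using False by blast
    then have ij: "i \<noteq> j" using diag by auto
    define c where "c = ?b j i"
    have sym: "m j i = m i j" using assms(1) i j ij by (auto simp: coxeter_matrix_def)
    have floors: "\<lfloor>- 1 :: real\<rfloor> = - 1" "\<lfloor>- 2 :: real\<rfloor> = - 2" by (simp_all add: floor_eq_iff)
    have c: "?b i j = - c" "c \<in> {1, -1, 2, -2}"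
      using burau_form_values[OF assms(1,2) i j(1) ij]
        burau_form_values[OF assms(1,2) j(1) i ij[symmetric]] sym j(2) ij floors
      unfolding c_def
      by (cases i j rule: linorder_cases; force simp: burau_form_int_def)+
    define s where "s = multiplicity 5 d"
    obtain e where e: "d = 5 ^ s * e" "\<not> 5 dvd e"
      using multiplicity_decompose'[of d 5] \<open>d \<ge> 2\<close> unfolding s_def by auto
    \<comment> \<open>If 5 does not divide \<open>d\<close>, then \<open>N = 1\<close> and the
      congruences modulo \<open>N\<close> are vacuous.\<close>
    define N :: int where "N = 5 ^ s"
    have N: "N > 0" "coprime 2 N" "coprime c N" "coprime (2 * c) N"
      using c(2) by (auto simp: N_def)
    obtain y where y: "[c * int y = - 1] (mod N)" using cong_solve_nat_multiple[OF N(3,1)] .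
    obtain x where x: "[c * int x = 1] (mod N)" using cong_solve_nat_multiple[OF N(3,1)] .
    obtain z where z: "[2 * c * int z = 1] (mod N)" using cong_solve_nat_multiple[OF N(4,1)] .
    \<comment> \<open>This lifts the conjugating matrix of \<open>transvection_conj_cong\<close> to
      the Artin group.\<close>
    define h where "h = ?a j [^]\<^bsub>?A\<^esub> z \<otimes>\<^bsub>?A\<^esub> (?a i [^]\<^bsub>?A\<^esub> x \<otimes>\<^bsub>?A\<^esub> ?a j [^]\<^bsub>?A\<^esub> y)"
    have h: "h \<in> carrier ?A" using i j cl by (simp add: h_def)
    define P where "P = burau n m h"
    have P: "P = transvection n j (\<lambda>l. int z * ?b j l) *
      (transvection n i (\<lambda>l. int x * ?b i l) * transvection n j (\<lambda>l. int y * ?b j l))"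
      using i j(1) cl by (simp add: P_def h_def GL_int_mult pow)
    have Pc: "P \<in> carrier_mat n n" unfolding P by simp
    let ?u = "h \<otimes>\<^bsub>?A\<^esub> ?a i [^]\<^bsub>?A\<^esub> e" and ?v = "?a i [^]\<^bsub>?A\<^esub> (4 * e) \<otimes>\<^bsub>?A\<^esub> h"
    have u: "burau n m ?u = P * transvection n i (\<lambda>l. int e * ?b i l)"
      and v: "burau n m ?v = transvection n i (\<lambda>l. 4 * int e * ?b i l) * P"
      using i h cl by (simp_all add: P_def GL_int_mult pow)
    have "reduce_mat d (burau n m ?u) = reduce_mat d (burau n m ?v)"
      unfolding u v
    proof (rule reduce_mat_eqI)
      fix k l assume kl: "k < n" "l < n"
      let ?U = "(P * transvection n i (\<lambda>l. int e * ?b i l)) $$ (k, l)"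
      let ?V = "(transvection n i (\<lambda>l. 4 * int e * ?b i l) * P) $$ (k, l)"
      have "[?U = ?V] (mod N)"
        unfolding P using i j(1) ij diag c(1) y x z N(2) kl
        by (intro transvection_conj_cong[where c = c]) (auto simp: c_def)
      \<comment> \<open>Both transvections are the identity modulo \<open>e\<close>, so both sides
        reduce to \<open>P\<close>.\<close>
      moreover have "[?U = ?V] (mod int e)"
        using Pc i kl by (simp add: mult_transvection_entry transvection_mult_entry row_form_smult
            cong_iff_dvd_diff del: index_mult_mat(1))
      moreover have "coprime N (int e)"
        using e(2) int_dvd_int_iff[of 5 e]
        by (auto simp: N_def intro!: disjI1 prime_imp_coprime)
      ultimately have "[?U = ?V] (mod (N * int e))" by (rule coprime_cong_mult)
      then show "[?U = ?V] (mod int d)" using e(1) by (simp add: N_def)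
    qed (use Pc in auto)
    moreover have "len_hom ?u \<noteq> len_hom ?v"
    proof
      assume "len_hom ?u = len_hom ?v"
      \<comment> \<open>The contribution of \<open>h\<close> cancels, which would leave
        \<open>3 * e\<close> divisible by 5.\<close>
      then have "(len_hom h + int e) mod 5 = (4 * int e + len_hom h) mod 5"
        using i h cl by (simp add: L.hom_nat_pow len_hom_gen mod_simps)
      then show False using e(2) by presburger
    qed
    moreover have "?u \<in> carrier ?A" "?v \<in> carrier ?A" using h cl i by simp_all
    ultimately show ?thesis by blast
  qed
qed

end
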